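(* Let $r\ge 2$, $d\ge 1$ be integers, $n=(r-1)(d+1)+1$, and let $A=\{a_1,\ldots,a_n\}\subset\mathbb{R}^d$ be a set of $n$ points whose $dn$ coordinates are algebraically independent (over $\mathbb{Q}$). Let $k\in\{0,1,\ldots,r-1\}$. Then there is a proper partition $\{A_1,\ldots,A_r\}$ of $A$ such that in the unique solution $(z,\alpha)$ of the system \[ z=\sum_{x\in A_j}\alpha(x)\,x \quad\text{and}\quad 1=\sum_{x\in A_j}\alpha(x)\qquad\text{for all } j\in[r], \] (unknowns $z\in\mathbb{R}^d$ and $\alpha(x)\in\mathbb{R}$ for $x\in A$) one has $\alpha(x)<0$ for exactly $k$ elements $x\in A$.
   Context: $[r]=\{1,\ldots,r\}$. A partition $\{A_1,\ldots,A_r\}$ of $A$ into $r$ parts is called proper if $1\le |A_j|\le d+1$ for every $j\in[r]$. For a proper partition and $A$ as in the claim, $\bigcap_{j=1}^r \operatorname{aff} A_j$ is a single point, equivalently the displayed linear system has a unique solution. The case $k=0$ is Tverberg's theorem. *)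

theory Defs
  imports "HOL-Analysis.Analysis"
begin

text \<open>Algebraic independence over the rationals of a finite family of reals
  x i (i in I): no nonzero polynomial with rational coefficients in the variables
  indexed by I vanishes at x.  A polynomial is given by a finitely supported
  coefficient function c on exponent vectors e :: 'i => nat (supported on I).\<close>
definition alg_indep_over_rat :: "'i set \<Rightarrow> ('i \<Rightarrow> real) \<Rightarrow> bool" where
  "alg_indep_over_rat I x \<longleftrightarrow>
     (\<forall>c :: ('i \<Rightarrow> nat) \<Rightarrow> real.
        finite {e. c e \<noteq> 0} \<and> (\<forall>e. c e \<in> \<rat>) \<and>
        (\<forall>e. c e \<noteq> 0 \<longrightarrow> (\<forall>i. i \<notin> I \<longrightarrow> e i = 0)) \<and>
        (\<Sum>e\<in>{e. c e \<noteq> 0}. c e * (\<Prod>i\<in>I. x i ^ e i)) = 0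
        \<longrightarrow> (\<forall>e. c e = 0))"

definition proper_partition :: "nat \<Rightarrow> 'a set \<Rightarrow> nat \<Rightarrow> (nat \<Rightarrow> 'a set) \<Rightarrow> bool" where
  "proper_partition d A r P \<longleftrightarrow>
     (\<forall>j<r. P j \<subseteq> A \<and> 1 \<le> card (P j) \<and> card (P j) \<le> d + 1) \<and>
     (\<forall>i<r. \<forall>j<r. i \<noteq> j \<longrightarrow> P i \<inter> P j = {}) \<and>
     (\<Union>j<r. P j) = A"

definition solves_system :: "nat \<Rightarrow> (nat \<Rightarrow> 'v::real_vector set) \<Rightarrow> 'v \<Rightarrow> ('v \<Rightarrow> real) \<Rightarrow> bool" where
  "solves_system r P z \<alpha> \<longleftrightarrow>
     (\<forall>j<r. z = (\<Sum>x\<in>P j. \<alpha> x *\<^sub>R x) \<and> (\<Sum>x\<in>P j. \<alpha> x) = 1)"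

end

theory Submission
  imports Defs
begin

text \<open>
  Fix the \<open>k\<close> points that come first in some coordinate direction and apply Sarkaria's tensor trick
  and the colourful Caratheodory theorem after reversing the sign of these points. This gives weights
  with the prescribed signs, and since \<open>k < r\<close> some part contains none of the \<open>k\<close> points, which
  forces the common sum of the weights over the parts to be positive. Genericity enters only through
  the fact that no solution of the system has a zero coefficient; uniqueness of the solution and the
  bound on the sizes of the parts follow from it.
\<close>

section \<open>Polynomial functions at an algebraically independent point\<close>

text \<open>The value of n is used twice. It exceeds by one the dimension (r-1)(d+1) of the tensor
  space, as the colourful theorem requires; and deleting one index leaves (r-1)(d+1) points, too few
  for the r affine hulls to meet generically. The second count is essential because the colourful
  theorem yields only weak signs, so some of the k weights could be zero instead of negative. The k
  points are cut off by a hyperplane because total zero would give, in some part, a common point of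
  the convex hulls of chosen and unchosen points.\<close>

inductive rat_poly_fun :: "'i set \<Rightarrow> (('i \<Rightarrow> real) \<Rightarrow> real) \<Rightarrow> bool" for I where
  const: "q \<in> \<rat> \<Longrightarrow> rat_poly_fun I (\<lambda>x. q)"
| var: "i \<in> I \<Longrightarrow> rat_poly_fun I (\<lambda>x. x i)"
| add: "rat_poly_fun I F \<Longrightarrow> rat_poly_fun I G \<Longrightarrow> rat_poly_fun I (\<lambda>x. F x + G x)"
| mult: "rat_poly_fun I F \<Longrightarrow> rat_poly_fun I G \<Longrightarrow> rat_poly_fun I (\<lambda>x. F x * G x)"

lemma rat_poly_fun_uminus: "rat_poly_fun I F \<Longrightarrow> rat_poly_fun I (\<lambda>x. - F x)"
  using rat_poly_fun.mult[OF rat_poly_fun.const[of "-1"], of I F] by simp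

lemma rat_poly_fun_diff:
  "rat_poly_fun I F \<Longrightarrow> rat_poly_fun I G \<Longrightarrow> rat_poly_fun I (\<lambda>x. F x - G x)"
  using rat_poly_fun.add[OF _ rat_poly_fun_uminus] by fastforce

lemma sum_list_mult_product:
  fixes f :: "'a \<Rightarrow> real"
  shows "sum_list (map f xs) * sum_list (map g ys)
    = sum_list (map (\<lambda>(x, y). f x * g y) (List.product xs ys))"
  by (induction xs) (simp_all add: algebra_simps sum_list_const_mult o_def)

text \<open>The list may repeat exponent vectors, so that a sum is a concatenation and a product the
  list of all pairs; like terms are merged only afterwards.\<close>

lemma rat_poly_fun_imp_terms:
  assumes "finite I" "rat_poly_fun I F"
  shows "\<exists>L :: (real \<times> ('i \<Rightarrow> nat)) list.
    (\<forall>t\<in>set L. fst t \<in> \<rat> \<and> (\<forall>i. i \<notin> I \<longrightarrow> snd t i = 0)) \<and>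
    (\<forall>x. F x = sum_list (map (\<lambda>t. fst t * (\<Prod>i\<in>I. x i ^ snd t i)) L))"
  using assms(2)
proof induction
  case (const q)
  show ?case by (rule exI[of _ "[(q, \<lambda>_. 0)]"]) (use const in simp)
next
  case (var j)
  have "(\<Prod>i\<in>I. x i ^ (if i = j then 1 else 0)) = x j" for x :: "'i \<Rightarrow> real"
    using prod.delta[OF assms(1), of j x] var by (simp add: if_distrib[of "(^) _"] cong: if_cong)
  then show ?case
    by (intro exI[of _ "[(1, \<lambda>i. if i = j then 1 else 0)]"]) (use var in auto)
next
  case (add F G)
  then obtain L1 L2 where
    "\<forall>t\<in>set L1. fst t \<in> \<rat> \<and> (\<forall>i. i \<notin> I \<longrightarrow> snd t i = 0)"
    "\<forall>t\<in>set L2. fst t \<in> \<rat> \<and> (\<forall>i. i \<notin> I \<longrightarrow> snd t i = 0)"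
    "\<forall>x. F x = sum_list (map (\<lambda>t. fst t * (\<Prod>i\<in>I. x i ^ snd t i)) L1)"
    "\<forall>x. G x = sum_list (map (\<lambda>t. fst t * (\<Prod>i\<in>I. x i ^ snd t i)) L2)" by blast
  then show ?case by (intro exI[of _ "L1 @ L2"]) auto
next
  case (mult F G)
  then obtain L1 L2 where L:
    "\<forall>t\<in>set L1. fst t \<in> \<rat> \<and> (\<forall>i. i \<notin> I \<longrightarrow> snd t i = 0)"
    "\<forall>t\<in>set L2. fst t \<in> \<rat> \<and> (\<forall>i. i \<notin> I \<longrightarrow> snd t i = 0)"
    "\<forall>x. F x = sum_list (map (\<lambda>t. fst t * (\<Prod>i\<in>I. x i ^ snd t i)) L1)"
    "\<forall>x. G x = sum_list (map (\<lambda>t. fst t * (\<Prod>i\<in>I. x i ^ snd t i)) L2)" by blast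
  let ?L = "map (\<lambda>(s, t). (fst s * fst t, \<lambda>i. snd s i + snd t i)) (List.product L1 L2)"
  have "F x * G x = sum_list (map (\<lambda>t. fst t * (\<Prod>i\<in>I. x i ^ snd t i)) ?L)" for x
    using L(3,4) by (simp add: sum_list_mult_product o_def case_prod_unfold power_add prod.distrib mult_ac)
  moreover have "\<forall>t\<in>set ?L. fst t \<in> \<rat> \<and> (\<forall>i. i \<notin> I \<longrightarrow> snd t i = 0)"
    using L(1,2) by auto
  ultimately show ?case by blast
qed

lemma sum_list_terms_collect:
  fixes g :: "'e \<Rightarrow> real"
  assumes "finite E" "snd ` set L \<subseteq> E"
  shows "sum_list (map (\<lambda>t. fst t * g (snd t)) L)
    = (\<Sum>e\<in>E. sum_list (map fst (filter (\<lambda>t. snd t = e) L)) * g e)"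
  using assms(2)
proof (induction L)
  case (Cons t L)
  have "(\<Sum>e\<in>E. sum_list (map fst (filter (\<lambda>t. snd t = e) (t # L))) * g e)
    = (\<Sum>e\<in>E. (if e = snd t then fst t * g e else 0)
        + sum_list (map fst (filter (\<lambda>t. snd t = e) L)) * g e)"
    by (intro sum.cong) (auto simp: algebra_simps)
  also have "\<dots> = fst t * g (snd t) + (\<Sum>e\<in>E. sum_list (map fst (filter (\<lambda>t. snd t = e) L)) * g e)"
    using assms(1) Cons.prems by (simp add: sum.distrib)
  finally show ?case using Cons by simp
qed simp

text \<open>Used in contrapositive form: a single \<open>y\<close> with
  \<open>F y \<noteq> 0\<close> certifies \<open>F x \<noteq> 0\<close>. Collecting like terms
  exposes the coefficients, which independence forces to vanish.\<close>

lemma alg_indep_rat_poly_fun_zero: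
  fixes x y :: "'i \<Rightarrow> real"
  assumes "finite I" "alg_indep_over_rat I x" "rat_poly_fun I F" "F x = 0"
  shows "F y = 0"
proof -
  obtain L :: "(real \<times> ('i \<Rightarrow> nat)) list" where
    L: "\<forall>t\<in>set L. fst t \<in> \<rat> \<and> (\<forall>i. i \<notin> I \<longrightarrow> snd t i = 0)" and
    F: "\<And>x. F x = sum_list (map (\<lambda>t. fst t * (\<Prod>i\<in>I. x i ^ snd t i)) L)"
    using rat_poly_fun_imp_terms[OF assms(1,3)] by blast
  define c where "c e = sum_list (map fst (filter (\<lambda>t. snd t = e) L))" for e
  have supp: "{e. c e \<noteq> 0} \<subseteq> snd ` set L"
  proof
    fix e assume "e \<in> {e. c e \<noteq> 0}"
    then have "filter (\<lambda>t. snd t = e) L \<noteq> []" by (auto simp: c_def)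
    then show "e \<in> snd ` set L" by (auto simp: filter_empty_conv)
  qed
  have fin: "finite {e. c e \<noteq> 0}" using supp finite_subset by blast
  have eval: "F w = (\<Sum>e | c e \<noteq> 0. c e * (\<Prod>i\<in>I. w i ^ e i))" for w
  proof -
    have "F w = (\<Sum>e\<in>snd ` set L. c e * (\<Prod>i\<in>I. w i ^ e i))"
      unfolding F c_def using sum_list_terms_collect[where g = "\<lambda>e. \<Prod>i\<in>I. w i ^ e i"] by blast
    also have "\<dots> = (\<Sum>e | c e \<noteq> 0. c e * (\<Prod>i\<in>I. w i ^ e i))"
      using supp by (intro sum.mono_neutral_right) auto
    finally show ?thesis .
  qed
  have rat: "c e \<in> \<rat>" for e
  proof -
    have "sum_list ys \<in> \<rat>" if "set ys \<subseteq> \<rat>" for ys :: "real list"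
      using that by (induction ys) auto
    moreover have "set (map fst (filter (\<lambda>t. snd t = e) L)) \<subseteq> \<rat>" using L by auto
    ultimately show ?thesis unfolding c_def by blast
  qed
  have vars: "e i = 0" if "c e \<noteq> 0" "i \<notin> I" for e i
  proof -
    have "e \<in> snd ` set L" using supp that(1) by blast
    then show ?thesis using L that(2) by auto
  qed
  have "\<forall>e. c e = 0"
    using assms(2)[unfolded alg_indep_over_rat_def, THEN spec, of c]
  proof (rule mp)
    show "finite {e. c e \<noteq> 0} \<and> (\<forall>e. c e \<in> \<rat>) \<and> (\<forall>e. c e \<noteq> 0 \<longrightarrow> (\<forall>i. i \<notin> I \<longrightarrow> e i = 0)) \<and>
        (\<Sum>e | c e \<noteq> 0. c e * (\<Prod>i\<in>I. x i ^ e i)) = 0"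
      using fin rat vars eval[of x] assms(4) by (intro conjI allI impI) auto
  qed
  then show ?thesis using eval[of y] by simp
qed

text \<open>Fraction-free elimination: a pivot that does not vanish at \<open>y\<close> is a nonzero polynomial,
  hence does not vanish at the generic point \<open>x\<close> either.\<close>
lemma generic_kernel_trivial:
  fixes M :: "'e \<Rightarrow> 'u \<Rightarrow> ('i \<Rightarrow> real) \<Rightarrow> real"
  assumes "finite I" "alg_indep_over_rat I x" "finite U"
    and "\<And>e u. e \<in> E \<Longrightarrow> u \<in> U \<Longrightarrow> rat_poly_fun I (M e u)"
    and "\<And>\<beta>. (\<forall>e\<in>E. (\<Sum>u\<in>U. M e u y * \<beta> u) = 0) \<Longrightarrow> \<forall>u\<in>U. \<beta> u = 0"
    and "\<forall>e\<in>E. (\<Sum>u\<in>U. M e u x * \<beta> u) = 0"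
  shows "\<forall>u\<in>U. \<beta> u = 0"
  using assms(3-6)
proof (induction U arbitrary: M rule: finite_induct)
  case (insert v U)
  have "\<exists>e\<in>E. M e v y \<noteq> 0"
  proof (rule ccontr)
    assume "\<not> ?thesis"
    \<comment> \<open>A column vanishing at \<open>y\<close> would put the unit vector at
      \<open>v\<close> into the kernel there.\<close>
    then have "\<forall>e\<in>E. (\<Sum>u\<in>insert v U. M e u y * (if u = v then 1 else 0)) = 0"
      using insert.hyps by (auto intro!: sum.neutral)
    from insert.prems(2)[OF this] show False by simp
  qed
  then obtain e0 where e0: "e0 \<in> E" "M e0 v y \<noteq> 0" by blast
  have piv: "M e0 v x \<noteq> 0"
    using alg_indep_rat_poly_fun_zero[OF assms(1,2) insert.prems(1)[OF e0(1)], of v y] e0(2) by auto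
  define M' where "M' e u w = M e0 v w * M e u w - M e v w * M e0 u w" for e u w
  have sum_M': "(\<Sum>u\<in>U. M' e u w * \<gamma> u)
     = M e0 v w * (\<Sum>u\<in>U. M e u w * \<gamma> u) - M e v w * (\<Sum>u\<in>U. M e0 u w * \<gamma> u)" for e w \<gamma>
    by (simp add: M'_def left_diff_distrib sum_subtractf sum_distrib_left mult.assoc)
  have U: "\<forall>u\<in>U. \<beta> u = 0"
  proof (rule insert.IH[of M'])
    fix e u assume "e \<in> E" "u \<in> U"
    then show "rat_poly_fun I (M' e u)"
      unfolding M'_def[abs_def] using e0 insert.prems(1)
      by (intro rat_poly_fun_diff rat_poly_fun.mult) auto
  next
    fix \<gamma> assume *: "\<forall>e\<in>E. (\<Sum>u\<in>U. M' e u y * \<gamma> u) = 0"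
    define X where "X e = (\<Sum>u\<in>U. M e u y * \<gamma> u)" for e
    \<comment> \<open>Back substitution: the value at \<open>v\<close> solves row \<open>e0\<close>,
      so a kernel vector of the reduced matrix at \<open>y\<close> extends to one of
      \<open>M\<close>.\<close>
    define \<gamma>' where "\<gamma>' = \<gamma>(v := - X e0 / M e0 v y)"
    have "(\<Sum>u\<in>insert v U. M e u y * \<gamma>' u) = 0" if "e \<in> E" for e
    proof -
      have "(\<Sum>u\<in>U. M e u y * \<gamma>' u) = X e"
        unfolding X_def using insert.hyps by (intro sum.cong) (auto simp: \<gamma>'_def)
      moreover have "M e0 v y * X e = M e v y * X e0" using * that unfolding sum_M' X_def by simp
      ultimately show ?thesis using insert.hyps e0(2) by (simp add: \<gamma>'_def field_simps)
    qed
    then have "\<forall>e\<in>E. (\<Sum>u\<in>insert v U. M e u y * \<gamma>' u) = 0" by blast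
    from insert.prems(2)[OF this] show "\<forall>u\<in>U. \<gamma> u = 0"
      using insert.hyps by (auto simp: \<gamma>'_def split: if_splits)
  next
    have eq: "(\<Sum>u\<in>U. M e u x * \<beta> u) = - M e v x * \<beta> v" if "e \<in> E" for e
      using insert.prems(3) that insert.hyps by fastforce
    show "\<forall>e\<in>E. (\<Sum>u\<in>U. M' e u x * \<beta> u) = 0"
      unfolding sum_M' using eq e0(1) by simp
  qed
  then have "(\<Sum>u\<in>insert v U. M e0 u x * \<beta> u) = M e0 v x * \<beta> v"
    using insert.hyps by simp
  then have "\<beta> v = 0" using insert.prems(3) e0(1) piv by simp
  with U show ?case by simp
qed simp

section \<open>Linear systems and finite sets\<close>

text \<open>Elimination again, now dividing by the pivot. It supplies both the dependence that
  removes a vertex from a simplex and the one that bounds the size of a part.\<close>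

lemma underdetermined_kernel_nontrivial:
  fixes M :: "'e \<Rightarrow> 'u \<Rightarrow> real"
  assumes "finite E" "finite U" "card E < card U"
  shows "\<exists>\<gamma>. (\<exists>u\<in>U. \<gamma> u \<noteq> 0) \<and> (\<forall>e\<in>E. (\<Sum>u\<in>U. M e u * \<gamma> u) = 0)"
  using assms
proof (induction E arbitrary: U M rule: finite_induct)
  case empty
  then have "U \<noteq> {}" by auto
  then show ?case by (intro exI[of _ "\<lambda>_. 1"]) auto
next
  case (insert e0 E)
  show ?case
  proof (cases "\<forall>u\<in>U. M e0 u = 0")
    case True
    obtain \<gamma> where "\<exists>u\<in>U. \<gamma> u \<noteq> 0" "\<forall>e\<in>E. (\<Sum>u\<in>U. M e u * \<gamma> u) = 0"
      using insert.IH[of U M] insert.prems insert.hyps by auto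
    then show ?thesis using True by (intro exI[of _ \<gamma>]) auto
  next
    case False
    then obtain v where v: "v \<in> U" "M e0 v \<noteq> 0" by blast
    have "card E < card (U - {v})" using insert.prems insert.hyps v by simp
    then obtain \<gamma> where \<gamma>: "\<exists>u\<in>U - {v}. \<gamma> u \<noteq> 0"
      "\<forall>e\<in>E. (\<Sum>u\<in>U - {v}. (M e u - M e v / M e0 v * M e0 u) * \<gamma> u) = 0"
      using insert.IH[of "U - {v}" "\<lambda>e u. M e u - M e v / M e0 v * M e0 u"] insert.prems(1) by blast
    define s where "s = (\<Sum>u\<in>U - {v}. M e0 u * \<gamma> u)"
    define \<gamma>' where "\<gamma>' = \<gamma>(v := - s / M e0 v)"
    have eq: "(\<Sum>u\<in>U. M e u * \<gamma>' u) = - M e v / M e0 v * s + (\<Sum>u\<in>U - {v}. M e u * \<gamma> u)" for e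
    proof -
      have "(\<Sum>u\<in>U. M e u * \<gamma>' u) = M e v * \<gamma>' v + (\<Sum>u\<in>U - {v}. M e u * \<gamma>' u)"
        by (rule sum.remove[OF insert.prems(1) v(1)])
      also have "(\<Sum>u\<in>U - {v}. M e u * \<gamma>' u) = (\<Sum>u\<in>U - {v}. M e u * \<gamma> u)"
        by (intro sum.cong) (auto simp: \<gamma>'_def)
      finally show ?thesis by (simp add: \<gamma>'_def)
    qed
    have "(\<Sum>u\<in>U. M e u * \<gamma>' u) = 0" if "e \<in> insert e0 E" for e
    proof (cases "e = e0")
      case True
      have "(\<Sum>u\<in>U. M e0 u * \<gamma>' u) = - M e0 v / M e0 v * s + s" unfolding eq by (simp add: s_def)
      then show ?thesis using v(2) True by simp
    next
      case False
      then have "(\<Sum>u\<in>U - {v}. M e u * \<gamma> u) - M e v / M e0 v * s = 0"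
        using \<gamma>(2) that by (simp add: left_diff_distrib sum_subtractf s_def sum_distrib_left mult.assoc)
      then show ?thesis unfolding eq by simp
    qed
    moreover have "\<exists>u\<in>U. \<gamma>' u \<noteq> 0" using \<gamma>(1) by (auto simp: \<gamma>'_def)
    ultimately show ?thesis by blast
  qed
qed

text \<open>Greedy choice: each set takes as much of the still uncovered part of \<open>W\<close> as
  its size allows and is then padded. It will provide the simplex vertices that each part omits,
  every vertex being omitted by some part.\<close>

lemma exists_cover_with_cards:
  fixes c :: "'j \<Rightarrow> nat"
  assumes "finite J" "finite X" "\<And>j. j \<in> J \<Longrightarrow> c j \<le> card X" "W \<subseteq> X" "card W \<le> (\<Sum>j\<in>J. c j)"
  shows "\<exists>F. (\<forall>j\<in>J. F j \<subseteq> X \<and> card (F j) = c j) \<and> W \<subseteq> (\<Union>j\<in>J. F j)"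
  using assms(1,3-5)
proof (induction J arbitrary: W rule: finite_induct)
  case empty
  then show ?case using finite_subset[OF _ assms(2)] by simp
next
  case (insert k J)
  have finW: "finite W" by (rule finite_subset[OF insert.prems(2) assms(2)])
  obtain V where V: "V \<subseteq> W" "card V = min (c k) (card W)"
    using obtain_subset_with_card_n[of "min (c k) (card W)" W] min.cobounded2 by metis
  have "card V \<le> c k" using V by simp
  then obtain G where G: "V \<subseteq> G" "G \<subseteq> X" "card G = c k"
    using exists_subset_between[of V "c k" X] insert.prems(1)[of k] V(1) insert.prems(2) assms(2)
    by (meson insertI1 order_trans)
  have "card (W - V) \<le> (\<Sum>j\<in>J. c j)"
    using V insert.prems(3) insert.hyps finW
    by (simp add: card_Diff_subset finite_subset)
  then have "\<exists>F. (\<forall>j\<in>J. F j \<subseteq> X \<and> card (F j) = c j) \<and> W - V \<subseteq> (\<Union>j\<in>J. F j)"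
    using insert.prems(1,2) by (intro insert.IH) auto
  then obtain F where F: "\<forall>j\<in>J. F j \<subseteq> X \<and> card (F j) = c j" "W - V \<subseteq> (\<Union>j\<in>J. F j)"
    by blast
  define F' where "F' = F(k := G)"
  have F': "F' k = G" "\<And>j. j \<in> J \<Longrightarrow> F' j = F j" using insert.hyps(2) by (auto simp: F'_def)
  have "W \<subseteq> (\<Union>j\<in>insert k J. F' j)"
  proof
    fix x assume "x \<in> W"
    show "x \<in> (\<Union>j\<in>insert k J. F' j)"
    proof (cases "x \<in> V")
      case True
      then show ?thesis using F'(1) G(1) by blast
    next
      case False
      then obtain j where "j \<in> J" "x \<in> F j" using F(2) \<open>x \<in> W\<close> by blast
      then show ?thesis using F'(2) by blast
    qed
  qed
  moreover have "\<forall>j\<in>insert k J. F' j \<subseteq> X \<and> card (F' j) = c j" using F(1) F' G by simp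
  ultimately show ?case by (intro exI[of _ F'] conjI)
qed

text \<open>Ranks are distinct and below \<open>card I\<close>, so each number below
  \<open>card I\<close> occurs as one.\<close>

lemma exists_rank:
  fixes h :: "'i \<Rightarrow> real"
  assumes "finite I" "inj_on h I" "k < card I"
  shows "\<exists>i0\<in>I. card {i \<in> I. h i < h i0} = k"
proof -
  let ?f = "\<lambda>x. card {i \<in> I. h i < h x}"
  have lt: "?f x < ?f y" if "x \<in> I" "y \<in> I" "h x < h y" for x y
    using that assms(1) by (intro psubset_card_mono) auto
  have "inj_on ?f I"
  proof (rule inj_onI)
    fix x y assume *: "x \<in> I" "y \<in> I" "?f x = ?f y"
    then have "h x = h y" using lt[of x y] lt[of y x] by (cases "h x" "h y" rule: linorder_cases) auto
    then show "x = y" using assms(2) * by (auto dest: inj_onD)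
  qed
  moreover have "?f ` I \<subseteq> {..<card I}"
    using assms(1) by (auto intro!: psubset_card_mono)
  ultimately have "?f ` I = {..<card I}"
    by (intro card_subset_eq) (auto simp: card_image)
  then show ?thesis using assms(3) by (metis (no_types, lifting) imageE lessThan_iff)
qed

section \<open>The colourful Caratheodory theorem\<close>

text \<open>Extending by zero from \<open>n\<close> on makes the simplex a closed subset of a
  product of compact intervals, so Tychonoff applies.\<close>

lemma compact_standard_simplex:
  "compact {\<beta> :: nat \<Rightarrow> real. (\<forall>i. 0 \<le> \<beta> i) \<and> (\<forall>i\<ge>n. \<beta> i = 0) \<and> (\<Sum>i<n. \<beta> i) = 1}"
    (is "compact ?S")
proof -
  let ?K = "PiE UNIV (\<lambda>i. {0..if i < n then 1 else (0::real)})"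
  have "compactin (product_topology (\<lambda>i::nat. euclidean :: real topology) UNIV) ?K"
    by (subst compactin_PiE) auto
  then have K: "compact ?K" by (simp add: euclidean_product_topology)
  have "closed {\<beta> :: nat \<Rightarrow> real. (\<Sum>i<n. \<beta> i) = 1}"
    by (intro closed_Collect_eq continuous_intros continuous_on_product_coordinates)
  with K have "compact (?K \<inter> {\<beta>. (\<Sum>i<n. \<beta> i) = 1})" by (rule compact_Int_closed)
  moreover have "?K \<inter> {\<beta>. (\<Sum>i<n. \<beta> i) = 1} = ?S"
  proof (intro equalityI subsetI)
    fix \<beta> assume *: "\<beta> \<in> ?S"
    have "\<beta> i \<le> 1" if "i < n" for i
      using member_le_sum[of i "{..<n}" \<beta>] * that by auto
    then show "\<beta> \<in> ?K \<inter> {\<beta>. (\<Sum>i<n. \<beta> i) = 1}" using * by (auto simp: PiE_iff)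
  next
    fix \<beta> assume *: "\<beta> \<in> ?K \<inter> {\<beta>. (\<Sum>i<n. \<beta> i) = 1}"
    have "\<beta> i \<in> {0..if i < n then 1 else 0}" for i using * by (auto simp: PiE_iff)
    then have "0 \<le> \<beta> i \<and> (i \<ge> n \<longrightarrow> \<beta> i = 0)" for i
      by (metis atLeastAtMost_iff linorder_not_less order_antisym)
    then show "\<beta> \<in> ?S" using * by auto
  qed
  ultimately show ?thesis by simp
qed

text \<open>Among all rainbow simplices take one whose distance to the origin is minimal, and suppose that
  its closest point \<open>p\<close> is nonzero. Since there are more colours than dimensions, \<open>p\<close> is a convex
  combination that omits some colour; exchanging the vertex of that colour for one in the half-space
  \<open>\<langle>p, x\<rangle> \<le> 0\<close> brings the simplex closer to the origin.\<close>
lemma colourful_caratheodory_zero: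
  fixes c :: "nat \<Rightarrow> nat \<Rightarrow> 'e \<Rightarrow> real"
  assumes "finite E" "card E < n" "0 < r"
    and zero: "\<And>i e. i < n \<Longrightarrow> e \<in> E \<Longrightarrow> (\<Sum>j<r. c i j e) = 0"
  shows "\<exists>\<sigma> \<beta>. (\<forall>i<n. \<sigma> i < r) \<and> (\<forall>i. 0 \<le> \<beta> i) \<and> (\<Sum>i<n. \<beta> i) = (1::real) \<and>
    (\<forall>e\<in>E. (\<Sum>i<n. \<beta> i * c i (\<sigma> i) e) = 0)"
proof -
  define S where "S = {\<beta> :: nat \<Rightarrow> real. (\<forall>i. 0 \<le> \<beta> i) \<and> (\<forall>i\<ge>n. \<beta> i = 0) \<and> (\<Sum>i<n. \<beta> i) = 1}"
  define R where "R = PiE {..<n} (\<lambda>_. {..<r})"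
  define pt where "pt \<sigma> \<beta> e = (\<Sum>i<n. \<beta> i * c i (\<sigma> i) e)" for \<sigma> \<beta> e
  define Q where "Q \<sigma> \<beta> = (\<Sum>e\<in>E. (pt \<sigma> \<beta> e)\<^sup>2)" for \<sigma> \<beta>
  have n: "0 < n" using assms(2) by simp
  have "(\<lambda>i. if i = 0 then 1 else 0) \<in> S" using n by (auto simp: S_def)
  then have "S \<noteq> {}" by blast
  have "\<exists>\<beta>\<in>S. \<forall>\<beta>'\<in>S. Q \<sigma> \<beta> \<le> Q \<sigma> \<beta>'" for \<sigma>
  proof (rule continuous_attains_inf)
    show "compact S" unfolding S_def by (rule compact_standard_simplex)
    show "continuous_on S (Q \<sigma>)" unfolding Q_def[abs_def] pt_def
      by (intro continuous_intros continuous_on_product_coordinates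
           continuous_on_subset[OF continuous_on_product_coordinates subset_UNIV])
  qed fact
  then obtain b where b: "\<And>\<sigma>. b \<sigma> \<in> S" "\<And>\<sigma> \<beta>. \<beta> \<in> S \<Longrightarrow> Q \<sigma> (b \<sigma>) \<le> Q \<sigma> \<beta>" by metis
  have "finite R" unfolding R_def by (intro finite_PiE) auto
  moreover have "R \<noteq> {}" unfolding R_def using assms(3) by (auto simp: PiE_eq_empty_iff)
  ultimately obtain s where s: "s \<in> R" "\<And>\<sigma>. \<sigma> \<in> R \<Longrightarrow> Q s (b s) \<le> Q \<sigma> (b \<sigma>)"
    using arg_min_if_finite(1)[of R "\<lambda>\<sigma>. Q \<sigma> (b \<sigma>)"] arg_min_least[of R _ "\<lambda>\<sigma>. Q \<sigma> (b \<sigma>)"] by metis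
  define m where "m = Q s (b s)"
  have min: "m \<le> Q \<sigma> \<beta>" if "\<sigma> \<in> R" "\<beta> \<in> S" for \<sigma> \<beta>
    using b(2)[OF that(2)] s(2)[OF that(1)] order_trans unfolding m_def by blast
  define p where "p = pt s (b s)"
  have m_p: "m = (\<Sum>e\<in>E. (p e)\<^sup>2)" by (simp add: m_def Q_def p_def)
  \<comment> \<open>First-order optimality of the minimum. It is stated for every rainbow simplex
    containing \<open>p\<close>, not only for \<open>s\<close>, because it is applied again after
    the exchange of a vertex.\<close>
  have support: "m \<le> (\<Sum>e\<in>E. p e * c k (\<sigma> k) e)"
    if \<sigma>: "\<sigma> \<in> R" and \<beta>: "\<beta> \<in> S" and p: "\<And>e. e \<in> E \<Longrightarrow> pt \<sigma> \<beta> e = p e" and k: "k < n" for \<sigma> \<beta> k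
  proof (rule ccontr)
    define \<delta> where "\<delta> = m - (\<Sum>e\<in>E. p e * c k (\<sigma> k) e)"
    define K where "K = (\<Sum>e\<in>E. (c k (\<sigma> k) e - p e)\<^sup>2)"
    assume "\<not> ?thesis"
    then have \<delta>: "\<delta> > 0" by (simp add: \<delta>_def)
    have K: "K \<ge> 0" unfolding K_def by (intro sum_nonneg) auto
    \<comment> \<open>Moving by \<open>t\<close> towards vertex \<open>k\<close> changes the squared
      distance by \<open>- 2 * t * \<delta> + t\<^sup>2 * K\<close>; this \<open>t\<close> is small
      enough to make that negative.\<close>
    define t where "t = min 1 (\<delta> / (1 + K))"
    have "t * (1 + K) \<le> \<delta> / (1 + K) * (1 + K)"
      using K by (intro mult_right_mono) (auto simp: t_def)
    then have t: "0 < t" "t \<le> 1" "t * (1 + K) \<le> \<delta>"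
      using \<delta> K by (auto simp: t_def)
    define \<beta>' where "\<beta>' i = (1 - t) * \<beta> i + (if i = k then t else 0)" for i
    have "\<beta>' \<in> S" using \<beta> t k
      by (auto simp: S_def \<beta>'_def sum.distrib sum_distrib_left[symmetric])
    have "pt \<sigma> \<beta>' e = p e + t * (c k (\<sigma> k) e - p e)" if "e \<in> E" for e
    proof -
      have "pt \<sigma> \<beta>' e = (\<Sum>i<n. (1 - t) * (\<beta> i * c i (\<sigma> i) e) + (if i = k then t * c k (\<sigma> k) e else 0))"
        unfolding pt_def \<beta>'_def by (intro sum.cong) (auto simp: algebra_simps)
      also have "\<dots> = (1 - t) * pt \<sigma> \<beta> e + t * c k (\<sigma> k) e"
        using k by (simp add: sum.distrib sum_distrib_left pt_def)
      finally show ?thesis using p[OF that] by (simp add: algebra_simps)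
    qed
    then have "Q \<sigma> \<beta>' = (\<Sum>e\<in>E. (p e + t * (c k (\<sigma> k) e - p e))\<^sup>2)" by (simp add: Q_def)
    also have "\<dots> = (\<Sum>e\<in>E. (p e)\<^sup>2 + 2 * t * (p e * c k (\<sigma> k) e - (p e)\<^sup>2) + t\<^sup>2 * (c k (\<sigma> k) e - p e)\<^sup>2)"
      by (intro sum.cong) (auto simp: power2_eq_square algebra_simps)
    also have "\<dots> = m - 2 * t * \<delta> + t\<^sup>2 * K"
      unfolding sum.distrib sum_subtractf sum_distrib_left[symmetric] m_p[symmetric] K_def[symmetric]
      by (simp add: \<delta>_def algebra_simps)
    finally have "2 * \<delta> \<le> t * K"
      using min[OF \<sigma> \<open>\<beta>' \<in> S\<close>] t(1) by (simp add: power2_eq_square mult.assoc)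
    then show False using t \<delta> by (simp add: algebra_simps)
  qed
  have inner_p: "(\<Sum>i<n. \<gamma> i * (\<Sum>e\<in>E. p e * c i (s i) e)) = (\<Sum>e\<in>E. p e * pt s \<gamma> e)" for \<gamma>
    unfolding pt_def sum_distrib_left by (subst sum.swap) (simp add: mult_ac)
  have "m = 0"
  proof (rule ccontr)
    assume "m \<noteq> 0"
    then have m: "m > 0" unfolding m_p by (simp add: sum_nonneg order_less_le)
    have "\<exists>\<beta>\<in>S. (\<forall>e\<in>E. pt s \<beta> e = p e) \<and> (\<exists>k<n. \<beta> k = 0)"
    proof (cases "\<exists>k<n. b s k = 0")
      case True
      then show ?thesis using b(1) by (intro bexI[of _ "b s"]) (auto simp: p_def)
    next
      case False
      have bS: "\<And>i. 0 \<le> b s i" "(\<Sum>i<n. b s i) = 1" "\<And>i. i \<ge> n \<Longrightarrow> b s i = 0"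
        using b(1)[of s] by (auto simp: S_def)
      have pos: "b s i > 0" if "i < n" for i using False bS(1)[of i] that by force
      \<comment> \<open>A sum of nonnegative terms with positive weights vanishes, so every vertex
        lies on the supporting hyperplane.\<close>
      have "(\<Sum>i<n. b s i * ((\<Sum>e\<in>E. p e * c i (s i) e) - m)) = 0"
        by (simp add: right_diff_distrib sum_subtractf inner_p sum_distrib_right[symmetric] bS(2))
          (simp add: p_def[symmetric] m_p power2_eq_square)
      moreover have "0 \<le> b s i * ((\<Sum>e\<in>E. p e * c i (s i) e) - m)" if "i < n" for i
        using support[OF s(1) b(1)] that bS(1) by (simp add: p_def)
      ultimately have "b s i * ((\<Sum>e\<in>E. p e * c i (s i) e) - m) = 0" if "i < n" for i
        using sum_nonneg_eq_0_iff[of "{..<n}" "\<lambda>i. b s i * ((\<Sum>e\<in>E. p e * c i (s i) e) - m)"] that by auto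
      then have face: "(\<Sum>e\<in>E. p e * c i (s i) e) = m" if "i < n" for i
        using pos[OF that] that by force
      obtain \<gamma> where \<gamma>: "\<exists>i<n. \<gamma> i \<noteq> 0" "\<forall>e\<in>E. pt s \<gamma> e = 0"
        using underdetermined_kernel_nontrivial[of E "{..<n}" "\<lambda>e i. c i (s i) e"] assms(1,2)
        by (auto simp: pt_def mult.commute)
      \<comment> \<open>All vertices have inner product \<open>m \<noteq> 0\<close> with
        \<open>p\<close>; pairing the linear relation with \<open>p\<close> therefore shows that it
        is an affine one.\<close>
      have "(\<Sum>i<n. \<gamma> i) * m = (\<Sum>i<n. \<gamma> i * (\<Sum>e\<in>E. p e * c i (s i) e))"
        by (simp add: face sum_distrib_right)
      also have "\<dots> = 0" unfolding inner_p using \<gamma>(2) by simp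
      finally have \<gamma>0: "(\<Sum>i<n. \<gamma> i) = 0" using m by simp
      define N where "N = {i. i < n \<and> \<gamma> i < 0}"
      have "N \<noteq> {}"
      proof
        assume "N = {}"
        then have "\<forall>i\<in>{..<n}. 0 \<le> \<gamma> i" by (force simp: N_def)
        then show False using \<gamma>(1) \<gamma>0 sum_nonneg_eq_0_iff[of "{..<n}" \<gamma>] by auto
      qed
      moreover have "finite N" by (simp add: N_def)
      \<comment> \<open>The minimal ratio marks the weight that vanishes first when moving along
        \<open>\<gamma>\<close>, which leaves the point \<open>p\<close> fixed.\<close>
      ultimately obtain k where k: "k \<in> N" "\<And>i. i \<in> N \<Longrightarrow> b s k / - \<gamma> k \<le> b s i / - \<gamma> i"
        using arg_min_if_finite(1)[of N "\<lambda>i. b s i / - \<gamma> i"]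
          arg_min_least[of N _ "\<lambda>i. b s i / - \<gamma> i"] by metis
      define t where "t = b s k / - \<gamma> k"
      have t: "t \<ge> 0" using k(1) bS(1)[of k] by (auto simp: t_def N_def field_simps)
      define \<beta> where "\<beta> i = b s i + t * (if i < n then \<gamma> i else 0)" for i
      have "0 \<le> \<beta> i" for i
      proof (cases "i \<in> N")
        case True
        then have "i < n" "\<gamma> i < 0" by (auto simp: N_def)
        moreover have "t \<le> b s i / - \<gamma> i" using k(2)[OF True] by (simp add: t_def)
        ultimately show ?thesis by (simp add: \<beta>_def field_simps)
      next
        case False
        then show ?thesis using t bS(1)[of i] by (auto simp: \<beta>_def N_def)
      qed
      then have "\<beta> \<in> S"
        using bS \<gamma>0 by (auto simp: S_def \<beta>_def sum.distrib sum_distrib_left[symmetric])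
      moreover have "\<beta> k = 0" "k < n" using k(1) by (auto simp: \<beta>_def t_def N_def)
      moreover have "pt s \<beta> e = p e" if "e \<in> E" for e
      proof -
        have "pt s \<beta> e = pt s (b s) e + t * pt s \<gamma> e"
          unfolding pt_def sum_distrib_left sum.distrib[symmetric]
          by (intro sum.cong) (auto simp: \<beta>_def algebra_simps)
        then show ?thesis using \<gamma>(2) that by (simp add: p_def)
      qed
      ultimately show ?thesis by blast
    qed
    then obtain \<beta> k where \<beta>: "\<beta> \<in> S" "\<And>e. e \<in> E \<Longrightarrow> pt s \<beta> e = p e" "k < n" "\<beta> k = 0" by blast
    have "(\<Sum>j<r. \<Sum>e\<in>E. p e * c k j e) = (\<Sum>e\<in>E. p e * (\<Sum>j<r. c k j e))"
      unfolding sum_distrib_left by (rule sum.swap)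
    also have "\<dots> = 0" using zero[OF \<beta>(3)] by simp
    finally have "\<exists>j<r. (\<Sum>e\<in>E. p e * c k j e) \<le> 0"
      using sum_pos[of "{..<r}" "\<lambda>j. \<Sum>e\<in>E. p e * c k j e"] assms(3)
      by (metis finite_lessThan lessThan_empty_iff lessThan_iff less_numeral_extra(3) not_le)
    then obtain j where j: "j < r" "(\<Sum>e\<in>E. p e * c k j e) \<le> 0" by blast
    \<comment> \<open>Since \<open>\<beta> k = 0\<close>, the exchange keeps \<open>p\<close> in the
      simplex, so \<open>support\<close> also applies to the new vertex and contradicts the choice
      of \<open>j\<close>.\<close>
    have "s(k := j) \<in> R" using s(1) \<beta>(3) j(1) by (auto simp: R_def PiE_iff extensional_def)
    moreover have "pt (s(k := j)) \<beta> e = p e" if "e \<in> E" for e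
    proof -
      have "pt (s(k := j)) \<beta> e = pt s \<beta> e" unfolding pt_def using \<beta>(4) by (intro sum.cong) auto
      then show ?thesis using \<beta>(2)[OF that] by simp
    qed
    ultimately have "m \<le> (\<Sum>e\<in>E. p e * c k j e)"
      using support[of "s(k := j)" \<beta> k] \<beta>(1,3) by simp
    then show False using j(2) m by simp
  qed
  then have "\<forall>e\<in>E. p e = 0" unfolding m_p using assms(1) by (simp add: sum_nonneg_eq_0_iff)
  then show ?thesis
    using s(1) b(1)[of s] unfolding p_def pt_def S_def R_def
    by (intro exI[of _ s] exI[of _ "b s"]) (auto simp: PiE_iff)
qed

section \<open>Generic point configurations\<close>

text \<open>Parts are fibres of \<open>\<sigma>\<close> on indices rather than sets of points, so
  that the coordinates \<open>(i, t)\<close> can serve as polynomial variables.\<close>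

definition solves_indexed ::
  "nat \<Rightarrow> nat \<Rightarrow> (nat \<Rightarrow> real ^ 'd) \<Rightarrow> (nat \<Rightarrow> nat) \<Rightarrow> real ^ 'd \<Rightarrow> (nat \<Rightarrow> real) \<Rightarrow> bool" where
  "solves_indexed r n a \<sigma> z \<alpha> \<longleftrightarrow>
     (\<forall>j<r. (\<Sum>i | i < n \<and> \<sigma> i = j. \<alpha> i *\<^sub>R a i) = z \<and> (\<Sum>i | i < n \<and> \<sigma> i = j. \<alpha> i) = 1)"

text \<open>Without the index \<open>i0\<close> the codimensions of the affine hulls of the parts add up to more than
  \<open>d\<close>. To see that such hulls do not meet for generic points it suffices, by
  \<open>generic_kernel_trivial\<close>, to look at one configuration: the points are vertices of a fixed simplex
  with vertex set \<open>'d option\<close>, chosen such that no vertex is used by all the parts.\<close>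
lemma generic_coefficient_nonzero:
  fixes a :: "nat \<Rightarrow> real ^ 'd"
  assumes r: "r \<ge> 1" and n: "n = (r - 1) * (CARD('d) + 1) + 1"
    and indep: "alg_indep_over_rat ({..<n} \<times> UNIV) (\<lambda>(i, t). a i $ t)"
    and \<sigma>: "\<forall>i<n. \<sigma> i < r"
    and sol: "solves_indexed r n a \<sigma> z \<alpha>"
    and i0: "i0 < n"
  shows "\<alpha> i0 \<noteq> 0"
proof
  assume \<alpha>0: "\<alpha> i0 = 0"
  define B where "B j = {i. i < n \<and> \<sigma> i = j \<and> i \<noteq> i0}" for j
  define D where "D = CARD('d) + 1"
  have D: "card (UNIV :: 'd option set) = D" by (simp add: D_def card_UNIV_option)
  \<comment> \<open>Only parts that fit injectively into the \<open>D\<close> simplex vertices are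
    kept. The discarded ones have negative deficit \<open>D - card (B j)\<close>, so the deficits of
    the kept ones still add up to at least \<open>D\<close>.\<close>
  define J where "J = {j. j < r \<and> card (B j) \<le> D}"
  have finB [simp]: "finite (B j)" for j by (simp add: B_def)
  have finJ [simp]: "finite J" by (simp add: J_def)
  have "{..<n} - {i0} = (\<Union>j<r. B j)" using \<sigma> by (auto simp: B_def)
  then have "card (\<Union>j<r. B j) = n - 1" using i0 by (metis card_Diff_singleton card_lessThan lessThan_iff)
  moreover have "card (\<Union>j<r. B j) = (\<Sum>j<r. card (B j))"
    by (intro card_UN_disjoint) (auto simp: B_def)
  ultimately have "(\<Sum>j<r. card (B j)) = n - 1" by simp
  also have "\<dots> + D = (\<Sum>j<r. D)" using r n D_def by (cases r) auto
  finally have "int (\<Sum>j<r. card (B j)) + int D = int r * int D"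
    by (metis card_lessThan of_nat_add of_nat_mult sum_constant of_nat_id)
  then have "int D = (\<Sum>j<r. int D - int (card (B j)))" by (simp add: sum_subtractf)
  also have "(\<Sum>j<r. int D - int (card (B j))) \<le> (\<Sum>j\<in>J. int D - int (card (B j)))"
  proof -
    have "(\<Sum>j<r. int D - int (card (B j))) = (\<Sum>j\<in>J. int D - int (card (B j)))
        + (\<Sum>j\<in>{..<r} - J. int D - int (card (B j)))"
      by (subst add.commute, rule sum.subset_diff) (auto simp: J_def)
    also have "(\<Sum>j\<in>{..<r} - J. int D - int (card (B j))) \<le> 0"
      by (intro sum_nonpos) (auto simp: J_def)
    finally show ?thesis by simp
  qed
  also have "(\<Sum>j\<in>J. int D - int (card (B j))) = int (\<Sum>j\<in>J. D - card (B j))"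
    unfolding of_nat_sum by (intro sum.cong) (auto simp: J_def)
  finally have "card (UNIV :: 'd option set) \<le> (\<Sum>j\<in>J. D - card (B j))" unfolding D by (simp only: of_nat_le_iff)
  then have "\<exists>F. (\<forall>j\<in>J. F j \<subseteq> (UNIV :: 'd option set) \<and> card (F j) = D - card (B j)) \<and>
      UNIV \<subseteq> (\<Union>j\<in>J. F j)"
    by (intro exists_cover_with_cards) (simp_all only: D finJ finite subset_UNIV diff_le_self)
  then obtain F :: "nat \<Rightarrow> 'd option set" where
    F: "\<forall>j\<in>J. card (F j) = D - card (B j)" and F_UNIV: "UNIV \<subseteq> (\<Union>j\<in>J. F j)" by blast
  have cover: "\<exists>j\<in>J. e \<in> F j" for e using F_UNIV by blast
  have "\<exists>\<phi>. bij_betw \<phi> (B j) (- F j)" if "j \<in> J" for j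
  proof (rule finite_same_card_bij)
    show "card (B j) = card (- F j)"
      using F that D by (simp add: Compl_eq_Diff_UNIV card_Diff_subset J_def)
  qed auto
  then obtain \<phi> where \<phi>: "\<And>j. j \<in> J \<Longrightarrow> bij_betw (\<phi> j) (B j) (- F j)" by metis
  define h where "h w i s = (case s of None \<Rightarrow> 1 | Some t \<Rightarrow> w (i, t))"
    for w :: "nat \<times> 'd \<Rightarrow> real" and i :: nat and s
  \<comment> \<open>\<open>Inl\<close> unknowns are the homogeneous coordinates of the common point,
    \<open>Inr\<close> unknowns the weights; the equations say that all kept parts represent the
    same vector.\<close>
  define U where "U = (UNIV :: 'd option set) <+> (\<Union>j\<in>J. B j)"
  define M where "M e u w = (case u of Inl s' \<Rightarrow> if snd e = s' then 1 else 0
      | Inr i \<Rightarrow> if \<sigma> i = fst e then - h w i (snd e) else 0)"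
    for e :: "nat \<times> 'd option" and u :: "'d option + nat" and w
  have row: "(\<Sum>u\<in>U. M (j, s) u w * \<beta> u) = \<beta> (Inl s) - (\<Sum>i\<in>B j. h w i s * \<beta> (Inr i))"
    if "j \<in> J" for j s w \<beta>
  proof -
    have "(\<Sum>i\<in>(\<Union>j\<in>J. B j). M (j, s) (Inr i) w * \<beta> (Inr i)) = (\<Sum>i\<in>B j. - (h w i s * \<beta> (Inr i)))"
      using that by (intro sum.mono_neutral_cong_right) (auto simp: M_def B_def)
    moreover have "(\<Sum>s'\<in>UNIV. M (j, s) (Inl s') w * \<beta> (Inl s')) = \<beta> (Inl s)"
      by (simp add: M_def if_distrib[of "\<lambda>x. x * _"] cong: if_cong)
    ultimately show ?thesis unfolding U_def
      by (subst sum.Plus) (auto simp: sum_negf)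
  qed
  define x where "x = (\<lambda>(i, t). a i $ t)"
  \<comment> \<open>The vertex \<open>Some t\<close> is the unit vector in direction
    \<open>t\<close>, and \<open>None\<close> is the origin.\<close>
  define y where "y = (\<lambda>(i, t). if \<phi> (\<sigma> i) i = Some t then 1 else (0::real))"
  define \<beta> where "\<beta> u = (case u of Inl None \<Rightarrow> 1 | Inl (Some t) \<Rightarrow> z $ t | Inr i \<Rightarrow> \<alpha> i)" for u
  have "\<forall>u\<in>U. \<beta> u = 0"
  proof (rule generic_kernel_trivial[where I = "{..<n} \<times> UNIV" and x = x and M = M and y = y
        and E = "J \<times> UNIV"])
    show "finite ({..<n} \<times> (UNIV :: 'd set))" by simp
    show "alg_indep_over_rat ({..<n} \<times> UNIV) x" using indep by (simp add: x_def)
    show "finite U" by (simp add: U_def)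
  next
    fix e :: "nat \<times> 'd option" and u assume "e \<in> J \<times> UNIV" and u: "u \<in> U"
    have h: "rat_poly_fun ({..<n} \<times> UNIV) (\<lambda>w. h w i s)" if "i < n" for i s
      unfolding h_def using that by (cases s) (auto intro: rat_poly_fun.const rat_poly_fun.var)
    show "rat_poly_fun ({..<n} \<times> UNIV) (M e u)"
    proof (cases u)
      case (Inl s)
      then show ?thesis unfolding M_def[abs_def] by (auto intro: rat_poly_fun.const)
    next
      case (Inr i)
      then have "i < n" using u by (auto simp: U_def B_def)
      then show ?thesis unfolding M_def[abs_def] Inr
        by (cases "\<sigma> i = fst e") (auto intro: rat_poly_fun.const rat_poly_fun_uminus h)
    qed
  next
    fix \<gamma> assume "\<forall>e\<in>J \<times> UNIV. (\<Sum>u\<in>U. M e u y * \<gamma> u) = 0"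
    then have eq: "\<gamma> (Inl s) = (\<Sum>i\<in>B j. h y i s * \<gamma> (Inr i))" if "j \<in> J" for j s
      using row[OF that, of s y \<gamma>] that by simp
    have \<phi>_eq: "\<phi> (\<sigma> i) i = \<phi> j i" if "i \<in> B j" for i j using that by (auto simp: B_def)
    have Some: "\<gamma> (Inl (Some t)) = (\<Sum>i\<in>B j. if \<phi> j i = Some t then \<gamma> (Inr i) else 0)"
      if "j \<in> J" for j t
      unfolding eq[OF that] by (intro sum.cong) (auto simp: h_def y_def \<phi>_eq)
    have None: "\<gamma> (Inl None) = (\<Sum>i\<in>B j. \<gamma> (Inr i))" if "j \<in> J" for j
      unfolding eq[OF that] by (simp add: h_def)
    have \<phi>_F: "\<phi> j i \<notin> F j" if "j \<in> J" "i \<in> B j" for i j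
      using \<phi>[OF that(1)] that(2) by (auto simp: bij_betw_def)
    have \<phi>_inj: "k = i" if "j \<in> J" "i \<in> B j" "k \<in> B j" "\<phi> j k = \<phi> j i" for i j k
      using \<phi>[OF that(1)] that(2-4) by (auto simp: bij_betw_def inj_on_def)
    \<comment> \<open>The coordinate \<open>t\<close> is common to all kept parts, and it is zero
      for a part that avoids the vertex \<open>Some t\<close>.\<close>
    have Some0: "\<gamma> (Inl (Some t)) = 0" for t
    proof -
      obtain j where j: "j \<in> J" "Some t \<in> F j" using cover by blast
      show ?thesis unfolding Some[OF j(1)]
        using \<phi>_F[OF j(1)] j(2) by (intro sum.neutral) force
    qed
    have Inr_Some: "\<gamma> (Inr i) = 0" if "j \<in> J" "i \<in> B j" "\<phi> j i = Some t" for i j t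
    proof -
      have "(\<Sum>k\<in>B j. if \<phi> j k = Some t then \<gamma> (Inr k) else 0) = (\<Sum>k\<in>B j. if k = i then \<gamma> (Inr k) else 0)"
      proof (rule sum.cong)
        fix k assume "k \<in> B j"
        then have "\<phi> j k = Some t \<longleftrightarrow> k = i" using \<phi>_inj[OF that(1,2)] that(3) by metis
        then show "(if \<phi> j k = Some t then \<gamma> (Inr k) else 0) = (if k = i then \<gamma> (Inr k) else 0)" by simp
      qed simp
      then show ?thesis using Some[OF that(1), of t] Some0 that(2) by simp
    qed
    \<comment> \<open>A part avoiding the origin has all its points at unit vectors, so its weights
      vanish and with them the common total.\<close>
    have None0: "\<gamma> (Inl None) = 0"
    proof -
      obtain j where j: "j \<in> J" "None \<in> F j" using cover by blast
      have "\<gamma> (Inr i) = 0" if "i \<in> B j" for i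
        using \<phi>_F[OF j(1) that] j(2) Inr_Some[OF j(1) that] by (cases "\<phi> j i") simp_all
      then show ?thesis unfolding None[OF j(1)] by simp
    qed
    have "\<gamma> (Inr i) = 0" if ij: "j \<in> J" "i \<in> B j" for i j
    proof (cases "\<phi> j i")
      case None': None
      \<comment> \<open>Only the weight at the origin is left in this part, and it equals the common
        total, which is zero.\<close>
      have "\<gamma> (Inr k) = (if k = i then \<gamma> (Inr k) else 0)" if "k \<in> B j" for k
      proof (cases "\<phi> j k")
        case None
        then have "k = i" using \<phi>_inj[OF ij that] None' by simp
        then show ?thesis by simp
      next
        case (Some t)
        then show ?thesis using Inr_Some[OF ij(1) that] by auto
      qed
      then have "(\<Sum>k\<in>B j. \<gamma> (Inr k)) = (\<Sum>k\<in>B j. if k = i then \<gamma> (Inr k) else 0)" by (rule sum.cong[OF refl])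
      then show ?thesis using None[OF ij(1)] None0 ij(2) by simp
    qed (use Inr_Some ij in blast)
    moreover have "\<gamma> (Inl s) = 0" for s using None0 Some0 by (cases s) auto
    ultimately show "\<forall>u\<in>U. \<gamma> u = 0" by (auto simp: U_def)
  next
    have "(\<Sum>u\<in>U. M (j, s) u x * \<beta> u) = 0" if "j \<in> J" for j s
    proof -
      have B: "(\<Sum>i | i < n \<and> \<sigma> i = j. f i) = (\<Sum>i\<in>B j. f i)" if "f i0 = 0" for f :: "nat \<Rightarrow> real"
        using that by (intro sum.mono_neutral_right) (auto simp: B_def)
      have "j < r" using that by (simp add: J_def)
      then have 1: "(\<Sum>i | i < n \<and> \<sigma> i = j. \<alpha> i) = 1" and
        2: "(\<Sum>i | i < n \<and> \<sigma> i = j. \<alpha> i *\<^sub>R a i) = z" using sol by (auto simp: solves_indexed_def)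
      have "(\<Sum>i | i < n \<and> \<sigma> i = j. \<alpha> i * a i $ t) = z $ t" for t
        by (simp flip: 2)
      then show ?thesis unfolding row[OF that] using 1 \<alpha>0
        by (cases s) (auto simp: \<beta>_def h_def x_def B mult.commute)
    qed
    then show "\<forall>e\<in>J \<times> UNIV. (\<Sum>u\<in>U. M e u x * \<beta> u) = 0" by auto
  qed
  then have "\<beta> (Inl None) = 0" by (auto simp: U_def)
  then show False by (simp add: \<beta>_def)
qed

text \<open>A second solution would span with the first an affine line of solutions, which contains one
  with a vanishing coefficient.\<close>
lemma generic_solution_unique:
  fixes a :: "nat \<Rightarrow> real ^ 'd"
  assumes r: "r \<ge> 1" and n: "n = (r - 1) * (CARD('d) + 1) + 1"
    and indep: "alg_indep_over_rat ({..<n} \<times> UNIV) (\<lambda>(i, t). a i $ t)"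
    and \<sigma>: "\<forall>i<n. \<sigma> i < r"
    and sol: "solves_indexed r n a \<sigma> z \<alpha>" "solves_indexed r n a \<sigma> z' \<alpha>'"
    and i: "i < n"
  shows "\<alpha>' i = \<alpha> i"
proof (rule ccontr)
  assume ne: "\<alpha>' i \<noteq> \<alpha> i"
  define t where "t = \<alpha> i / (\<alpha> i - \<alpha>' i)"
  define \<alpha>'' where "\<alpha>'' k = (1 - t) * \<alpha> k + t * \<alpha>' k" for k
  have "solves_indexed r n a \<sigma> ((1 - t) *\<^sub>R z + t *\<^sub>R z') \<alpha>''"
    using sol unfolding solves_indexed_def \<alpha>''_def
    by (simp add: scaleR_left_distrib sum.distrib sum_distrib_left[symmetric]
        scaleR_sum_right[symmetric] flip: scaleR_scaleR)
  then have "\<alpha>'' i \<noteq> 0" by (rule generic_coefficient_nonzero[OF r n indep \<sigma> _ i])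
  moreover have "\<alpha>'' i = \<alpha> i - t * (\<alpha> i - \<alpha>' i)" by (simp add: \<alpha>''_def algebra_simps)
  ultimately show False using ne by (simp add: t_def)
qed

text \<open>More than d + 1 points in a part are affinely dependent, and adding a dependence to the
  weights would give a second solution.\<close>

lemma generic_part_card_le:
  fixes a :: "nat \<Rightarrow> real ^ 'd"
  assumes r: "r \<ge> 1" and n: "n = (r - 1) * (CARD('d) + 1) + 1"
    and indep: "alg_indep_over_rat ({..<n} \<times> UNIV) (\<lambda>(i, t). a i $ t)"
    and \<sigma>: "\<forall>i<n. \<sigma> i < r"
    and sol: "solves_indexed r n a \<sigma> z \<alpha>"
  shows "card {i. i < n \<and> \<sigma> i = j} \<le> CARD('d) + 1"
proof (rule ccontr)
  let ?A = "{i. i < n \<and> \<sigma> i = j}"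
  assume "\<not> ?thesis"
  then have "card (UNIV :: 'd option set) < card ?A" by (simp add: card_UNIV_option)
  then obtain \<gamma> where \<gamma>: "\<exists>i\<in>?A. \<gamma> i \<noteq> 0"
    "\<And>s :: 'd option. (\<Sum>i\<in>?A. (case s of None \<Rightarrow> 1 | Some t \<Rightarrow> a i $ t) * \<gamma> i) = 0"
    using underdetermined_kernel_nontrivial[of "UNIV :: 'd option set" ?A
        "\<lambda>s i. case s of None \<Rightarrow> 1 | Some t \<Rightarrow> a i $ t"] by auto
  have \<gamma>1: "(\<Sum>i\<in>?A. \<gamma> i) = 0" using \<gamma>(2)[of None] by simp
  have \<gamma>2: "(\<Sum>i\<in>?A. \<gamma> i *\<^sub>R a i) = 0"
    using \<gamma>(2)[of "Some _"] by (simp add: vec_eq_iff mult.commute)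
  define \<alpha>' where "\<alpha>' i = (if \<sigma> i = j then \<alpha> i + \<gamma> i else \<alpha> i)" for i
  have "solves_indexed r n a \<sigma> z \<alpha>'"
    unfolding solves_indexed_def
  proof (intro allI impI)
    fix l assume l: "l < r"
    show "(\<Sum>i | i < n \<and> \<sigma> i = l. \<alpha>' i *\<^sub>R a i) = z \<and> (\<Sum>i | i < n \<and> \<sigma> i = l. \<alpha>' i) = 1"
    proof (cases "l = j")
      case True
      then show ?thesis using sol l \<gamma>1 \<gamma>2
        by (simp add: \<alpha>'_def solves_indexed_def scaleR_left_distrib sum.distrib)
    next
      case False
      then show ?thesis using sol l by (simp add: \<alpha>'_def solves_indexed_def)
    qed
  qed
  then have "\<alpha>' i = \<alpha> i" if "i < n" for i
    using generic_solution_unique[OF r n indep \<sigma> sol] that by blast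
  moreover obtain i where "i < n" "\<sigma> i = j" "\<gamma> i \<noteq> 0" using \<gamma>(1) by blast
  ultimately show False by (force simp: \<alpha>'_def)
qed

text \<open>\<open>T\<close> consists of the \<open>k\<close> points with the smallest \<open>t0\<close>-th coordinate. With \<open>\<epsilon> = -1\<close> on \<open>T\<close> and
  \<open>\<epsilon> = 1\<close> elsewhere, Sarkaria's vectors \<open>\<epsilon> i (a i, 1) \<otimes> v j\<close>, where \<open>v 0, \<dots>, v (r - 2)\<close> is the
  standard basis and \<open>v (r - 1)\<close> minus its sum, yield weights \<open>\<alpha>\<close> that are at most 0 on \<open>T\<close>, at least
  0 elsewhere, and have the same total \<open>s\<close> on every part. A part missing \<open>T\<close> shows \<open>s \<ge> 0\<close>; and
  \<open>s = 0\<close> would make each part affinely dependent with a sign pattern that the hyperplane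
  separating \<open>T\<close> from the other points forbids.\<close>
lemma exists_signed_solution:
  fixes a :: "nat \<Rightarrow> real ^ 'd"
  assumes r: "r \<ge> 1" and n: "n = (r - 1) * (CARD('d) + 1) + 1" and k: "k < r" "k < n"
    and inj: "inj_on (\<lambda>i. a i $ t0) {..<n}"
  obtains T \<sigma> z \<alpha> where "T \<subseteq> {..<n}" "card T = k" "\<forall>i<n. \<sigma> i < r"
    "solves_indexed r n a \<sigma> z \<alpha>" "\<And>i. i \<in> T \<Longrightarrow> \<alpha> i \<le> 0" "\<And>i. i < n \<Longrightarrow> i \<notin> T \<Longrightarrow> \<alpha> i \<ge> 0"
proof -
  obtain m where m: "m < n" "card {i \<in> {..<n}. a i $ t0 < a m $ t0} = k"
    using exists_rank[OF _ inj, of k] k by auto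
  \<comment> \<open>Exactly \<open>k\<close> points lie strictly below \<open>\<theta>\<close>, and
    \<open>m\<close> itself lies on the separating hyperplane.\<close>
  define \<theta> where "\<theta> = a m $ t0"
  define T where "T = {i \<in> {..<n}. a i $ t0 < \<theta>}"
  have cardT: "card T = k" "finite T" using m by (auto simp: T_def \<theta>_def)
  define \<epsilon> :: "nat \<Rightarrow> real" where "\<epsilon> i = (if i \<in> T then -1 else 1)" for i
  define h where "h i s = (case s of None \<Rightarrow> 1 | Some t \<Rightarrow> a i $ t)" for i s
  define v :: "nat \<Rightarrow> nat \<Rightarrow> real" where "v j l = (if j = l then 1 else if j = r - 1 then -1 else 0)" for j l
  define c where "c i j e = \<epsilon> i * h i (snd e) * v j (fst e)" for i j and e :: "nat \<times> 'd option"
  have v_sum: "(\<Sum>j<r. v j l) = 0" if "l < r - 1" for l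
  proof -
    have "(\<Sum>j<r. v j l) = (\<Sum>j<r. (if j = l then 1 else 0) - (if j = r - 1 then 1 else 0))"
      using that by (intro sum.cong) (auto simp: v_def)
    then show ?thesis using that by (simp add: sum_subtractf)
  qed
  obtain \<sigma> \<beta> where \<sigma>: "\<And>i. i < n \<Longrightarrow> \<sigma> i < r" and \<beta>: "\<And>i. 0 \<le> \<beta> i" "(\<Sum>i<n. \<beta> i) = (1::real)"
    and eq: "\<And>l s. l < r - 1 \<Longrightarrow> (\<Sum>i<n. \<beta> i * c i (\<sigma> i) (l, s)) = 0"
  proof -
    have "card ({..<r - 1} \<times> (UNIV :: 'd option set)) < n"
      by (simp add: card_cartesian_product card_UNIV_option n)
    moreover have "(\<Sum>j<r. c i j e) = 0" if "e \<in> {..<r - 1} \<times> UNIV" for i e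
      using v_sum that by (auto simp: c_def simp flip: sum_distrib_left)
    ultimately have "\<exists>\<sigma> \<beta>. (\<forall>i<n. \<sigma> i < r) \<and> (\<forall>i. 0 \<le> \<beta> i) \<and> (\<Sum>i<n. \<beta> i) = (1::real) \<and>
      (\<forall>e\<in>{..<r - 1} \<times> UNIV. (\<Sum>i<n. \<beta> i * c i (\<sigma> i) e) = 0)"
      using r by (intro colourful_caratheodory_zero) auto
    then obtain \<sigma> \<beta> where *: "\<forall>i<n. \<sigma> i < r" "\<forall>i. 0 \<le> \<beta> i" "(\<Sum>i<n. \<beta> i) = (1::real)"
      "\<forall>e\<in>{..<r - 1} \<times> UNIV. (\<Sum>i<n. \<beta> i * c i (\<sigma> i) e) = 0" by blast
    show ?thesis by (rule that[of \<sigma> \<beta>]) (use * in auto)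
  qed
  define \<alpha> where "\<alpha> i = \<epsilon> i * \<beta> i" for i
  have \<alpha>_sign: "i \<in> T \<Longrightarrow> \<alpha> i \<le> 0" "i \<notin> T \<Longrightarrow> \<alpha> i \<ge> 0" for i
    using \<beta>(1)[of i] by (auto simp: \<alpha>_def \<epsilon>_def)
  define A where "A j = {i. i < n \<and> \<sigma> i = j}" for j
  have finA [simp]: "finite (A j)" for j by (simp add: A_def)
  define w where "w s = (\<Sum>i\<in>A (r - 1). \<alpha> i * h i s)" for s
  \<comment> \<open>Coordinate \<open>j\<close> of the tensor relation compares part
    \<open>j\<close>, with entry 1, and part \<open>r - 1\<close>, with entry -1.\<close>
  have w: "(\<Sum>i\<in>A j. \<alpha> i * h i s) = w s" if "j < r" for j s
  proof (cases "j = r - 1")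
    case False
    then have j: "j < r - 1" using that by simp
    have "(\<Sum>i<n. \<beta> i * c i (\<sigma> i) (j, s)) = (\<Sum>i<n. (if \<sigma> i = j then \<alpha> i * h i s else 0) - (if \<sigma> i = r - 1 then \<alpha> i * h i s else 0))"
      using j by (intro sum.cong) (auto simp: c_def \<alpha>_def v_def)
    also have "\<dots> = (\<Sum>i\<in>A j. \<alpha> i * h i s) - w s"
      by (simp add: sum_subtractf w_def A_def sum.inter_filter[symmetric] lessThan_def)
    finally show ?thesis using eq[OF j] by simp
  qed (simp add: w_def)
  have "\<exists>j<r. A j \<inter> T = {}"
  proof (rule ccontr)
    assume "\<not> ?thesis"
    then have "{..<r} \<subseteq> \<sigma> ` T" by (force simp: A_def)
    then have "r \<le> card (\<sigma> ` T)" using card_mono[of "\<sigma> ` T" "{..<r}"] cardT(2) by simp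
    then show False using card_image_le[OF cardT(2), of \<sigma>] cardT(1) k by simp
  qed
  then obtain q where q: "q < r" "A q \<inter> T = {}" by blast
  have \<alpha>q: "\<alpha> i \<ge> 0" if "i \<in> A q" for i using \<alpha>_sign(2) q(2) that by blast
  have wq: "w None = (\<Sum>i\<in>A q. \<alpha> i)" using w[OF q(1), of None] by (simp add: h_def)
  then have w_ge: "w None \<ge> 0" using \<alpha>q by (simp add: sum_nonneg)
  have w_pos: "w None > 0"
  proof (rule ccontr)
    assume "\<not> ?thesis"
    then have wN: "w None = 0" using w_ge by simp
    \<comment> \<open>Part \<open>q\<close> has only nonnegative weights, so total zero kills them
      all, and the vector \<open>w\<close> shared by all parts vanishes in every coordinate.\<close>
    then have "\<forall>i\<in>A q. \<alpha> i = 0" using wq \<alpha>q by (simp add: sum_nonneg_eq_0_iff)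
    then have w0: "w s = 0" for s using w[OF q(1), of s] by simp
    have zero: "\<alpha> i = 0" if "j < r" "i \<in> A j" for i j
    proof -
      have s0: "(\<Sum>i\<in>A j. \<alpha> i) = 0" using w[OF that(1), of None] w0 by (simp add: h_def)
      have "(\<Sum>i\<in>A j. \<alpha> i * a i $ t0) = 0" using w[OF that(1), of "Some t0"] w0 by (simp add: h_def)
      then have "(\<Sum>i\<in>A j. \<alpha> i * (a i $ t0 - \<theta>)) = 0"
        using s0 by (simp add: right_diff_distrib sum_subtractf flip: sum_distrib_right)
      \<comment> \<open>The weight and the height above \<open>\<theta>\<close> never have opposite
        signs, so each term vanishes. This settles only \<open>T\<close>, since other points may lie
        on the hyperplane; their weights follow from the zero total.\<close>
      moreover have "0 \<le> \<alpha> i * (a i $ t0 - \<theta>)" if "i \<in> A j" for i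
        using \<alpha>_sign[of i] that by (cases "i \<in> T") (auto simp: T_def A_def mult_nonpos_nonpos)
      ultimately have "\<forall>i\<in>A j. \<alpha> i * (a i $ t0 - \<theta>) = 0" by (simp add: sum_nonneg_eq_0_iff)
      then have T0: "\<alpha> i = 0" if "i \<in> A j" "i \<in> T" for i using that by (force simp: T_def)
      have "0 \<le> \<alpha> i" if "i \<in> A j" for i using T0[OF that] \<alpha>_sign(2)[of i] by (cases "i \<in> T") auto
      then show ?thesis using s0 that(2) by (simp add: sum_nonneg_eq_0_iff)
    qed
    have "\<beta> i = 0" if "i < n" for i
      using zero[OF \<sigma>[OF that], of i] that by (auto simp: A_def \<alpha>_def \<epsilon>_def split: if_splits)
    then show False using \<beta>(2) by simp
  qed
  define z :: "real ^ 'd" where "z = (\<chi> t. w (Some t) / w None)"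
  have "solves_indexed r n a \<sigma> z (\<lambda>i. \<alpha> i / w None)"
    unfolding solves_indexed_def A_def[symmetric]
  proof (intro allI impI conjI)
    fix j assume j: "j < r"
    show "(\<Sum>i\<in>A j. \<alpha> i / w None) = 1"
      using w[OF j, of None] w_pos by (simp add: h_def flip: sum_divide_distrib)
    show "(\<Sum>i\<in>A j. (\<alpha> i / w None) *\<^sub>R a i) = z"
      using w[OF j, of "Some _"] by (simp add: vec_eq_iff z_def h_def flip: sum_divide_distrib)
  qed
  then show ?thesis
    using that[of T \<sigma> z "\<lambda>i. \<alpha> i / w None"] cardT \<sigma> \<alpha>_sign w_pos
    by (auto simp: T_def divide_nonpos_pos)
qed

section \<open>Transfer from indices to partitions of the point set\<close>

theorem mainTheorem1:
  fixes a :: "nat \<Rightarrow> real ^ 'd" and r n k :: nat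
  assumes "r \<ge> 2"
    and "n = (r - 1) * (CARD('d) + 1) + 1"
    and "alg_indep_over_rat ({..<n} \<times> UNIV) (\<lambda>(i, t). a i $ t)"
    and "k \<le> r - 1"
  shows "\<exists>P. proper_partition CARD('d) (a ` {..<n}) r P \<and>
           (\<exists>z \<alpha>. solves_system r P z \<alpha> \<and>
              (\<forall>z' \<alpha>'. solves_system r P z' \<alpha>' \<longrightarrow>
                   z' = z \<and> (\<forall>x\<in>a ` {..<n}. \<alpha>' x = \<alpha> x)) \<and>
              card {x \<in> a ` {..<n}. \<alpha> x < 0} = k)"
proof -
  have r: "r \<ge> 1" using assms(1) by simp
  note generic = r assms(2,3)
  obtain t0 :: 'd where True by simp
  have injt: "inj_on (\<lambda>i. a i $ t0) {..<n}"
  proof (rule inj_onI, rule ccontr)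
    fix i j assume *: "i \<in> {..<n}" "j \<in> {..<n}" "a i $ t0 = a j $ t0" "i \<noteq> j"
    have "rat_poly_fun ({..<n} \<times> UNIV) (\<lambda>x. x (i, t0) - x (j, t0))"
      using * by (intro rat_poly_fun_diff rat_poly_fun.var) auto
    \<comment> \<open>The difference of the two variables is 1 at the indicator of
      \<open>(i, t0)\<close>, hence cannot vanish at the generic point.\<close>
    from alg_indep_rat_poly_fun_zero[OF _ assms(3) this,
        of "\<lambda>u. if u = (i, t0) then 1 else 0"] * show False by simp
  qed
  have inj: "inj_on a {..<n}" using injt by (auto simp: inj_on_def)
  have "r - 1 \<le> (r - 1) * (CARD('d) + 1)" by simp
  then have "k < r" "k < n" using assms(1,2,4) by linarith+
  from exists_signed_solution[OF r assms(2) this injt]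
  obtain T \<sigma> z \<alpha> where T: "T \<subseteq> {..<n}" "card T = k" and \<sigma>: "\<forall>i<n. \<sigma> i < r"
    and sol: "solves_indexed r n a \<sigma> z \<alpha>"
    and sign: "\<And>i. i \<in> T \<Longrightarrow> \<alpha> i \<le> 0" "\<And>i. i < n \<Longrightarrow> i \<notin> T \<Longrightarrow> \<alpha> i \<ge> 0" by metis
  define A where "A j = {i. i < n \<and> \<sigma> i = j}" for j
  define P where "P j = a ` A j" for j
  have A: "A j \<subseteq> {..<n}" "finite (A j)" for j by (auto simp: A_def)
  have injA: "inj_on a (A j)" for j using inj A(1) inj_on_subset by blast
  have system_iff: "solves_system r P z' \<alpha>' \<longleftrightarrow> solves_indexed r n a \<sigma> z' (\<alpha>' \<circ> a)" for z' \<alpha>'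
    unfolding solves_system_def solves_indexed_def P_def A_def[symmetric]
    by (auto simp: sum.reindex[OF injA])
  define \<alpha>' where "\<alpha>' = \<alpha> \<circ> the_inv_into {..<n} a"
  have \<alpha>': "\<alpha>' (a i) = \<alpha> i" if "i < n" for i
    using that inj by (simp add: \<alpha>'_def the_inv_into_f_f)
  have "solves_indexed r n a \<sigma> z (\<alpha>' \<circ> a)"
    using sol \<alpha>' by (auto simp: solves_indexed_def)
  then have sys: "solves_system r P z \<alpha>'" by (simp add: system_iff)
  have nonempty: "A j \<noteq> {}" if "j < r" for j
    using sol that unfolding solves_indexed_def A_def[symmetric] by force
  have "proper_partition CARD('d) (a ` {..<n}) r P"
    unfolding proper_partition_def
  proof (intro conjI allI impI)
    fix j assume j: "j < r"
    show "P j \<subseteq> a ` {..<n}" using A by (auto simp: P_def)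
    show "1 \<le> card (P j)" using nonempty[OF j] A(2)[of j] by (simp add: P_def Suc_le_eq card_gt_0_iff)
    show "card (P j) \<le> CARD('d) + 1"
      using generic_part_card_le[OF generic \<sigma> sol, of j] card_image[OF injA] by (simp add: P_def A_def)
  next
    fix i j assume "i < r" "j < r" "i \<noteq> j"
    then show "P i \<inter> P j = {}" using inj by (auto simp: P_def A_def dest!: inj_onD)
  next
    show "(\<Union>j<r. P j) = a ` {..<n}" using \<sigma> by (auto simp: P_def A_def)
  qed
  moreover have "z' = z \<and> (\<forall>x\<in>a ` {..<n}. \<alpha>2 x = \<alpha>' x)" if "solves_system r P z' \<alpha>2" for z' \<alpha>2
  proof -
    have eq: "(\<alpha>2 \<circ> a) i = \<alpha> i" if "i < n" for i
      using generic_solution_unique[OF generic \<sigma> sol _ that] \<open>solves_system r P z' \<alpha>2\<close> system_iff by blast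
    then have "z' = z"
      using that[unfolded system_iff] sol r unfolding solves_indexed_def
      by (metis (mono_tags, lifting) less_le_trans mem_Collect_eq sum.cong zero_less_one)
    then show ?thesis using eq \<alpha>' by auto
  qed
  moreover have "card {x \<in> a ` {..<n}. \<alpha>' x < 0} = k"
  proof -
    \<comment> \<open>Nonvanishing turns the weak signs into strict ones, so the negative weights
      are exactly those on \<open>T\<close>.\<close>
    have "\<alpha> i < 0 \<longleftrightarrow> i \<in> T" if "i < n" for i
      using generic_coefficient_nonzero[OF generic \<sigma> sol that] sign that by force
    then have "{x \<in> a ` {..<n}. \<alpha>' x < 0} = a ` T" using \<alpha>' T(1) by auto
    then show ?thesis using T card_image[OF inj_on_subset[OF inj T(1)]] by simp
  qed
  ultimately show ?thesis using sys by blast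
qed

end
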